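(* There is an absolute constant $C>0$ such that the following holds. Let $B\in\mathbb{C}^{m\times n}$, $E\in\mathbb{C}^{s\times n}$, $A=\begin{pmatrix}B\\ E\end{pmatrix}\in\mathbb{C}^{(m+s)\times n}$, and let $1\le k<\min(m,n)$. Define $$Z=\begin{pmatrix}u^{(1)},\ldots,u^{(k)} & 0\\ 0 & I_s\end{pmatrix}\in\mathbb{C}^{(m+s)\times(k+s)}.$$ For any $i=1,\ldots,k$ with $\widehat{\sigma}_i\ne\sigma_{k+1}$, let $\widehat{y}^{(i)}\in\mathbb{C}^s$ be the vector of the last $s$ entries of the left singular vector $\widehat{u}^{(i)}$ of $A$ associated with $\widehat{\sigma}_i$, and set $\gamma=C\left\|E^H\widehat{y}^{(i)}\right\|$. Then $$\min_{z\in\mathrm{range}(Z)}\left\|\widehat{u}^{(i)}-z\right\|\le\left|\frac{\gamma\,\sigma_{k+1}}{\sigma_{k+1}^2-\widehat{\sigma}_i^2}\right|.$$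
   Context: The full SVD of $B$ is $B=U\Sigma V^H$, where $U\in\mathbb{C}^{m\times m}$ and $V\in\mathbb{C}^{n\times n}$ are unitary with $j$-th columns $u^{(j)}$ and $v^{(j)}$ (left and right singular vectors of $B$), and $\Sigma\in\mathbb{R}^{m\times n}$ has nonzero entries only on its main diagonal, equal to the singular values $\sigma_1\ge\cdots\ge\sigma_{\min(m,n)}\ge 0$. The singular values of $A$ are $\widehat{\sigma}_1\ge\widehat{\sigma}_2\ge\cdots\ge 0$, with left singular vectors $\widehat{u}^{(1)},\widehat{u}^{(2)},\ldots$ from a full SVD of $A$. $I_p$ denotes the $p\times p$ identity matrix, ${}^H$ the conjugate transpose, $\|\cdot\|$ the Euclidean norm of vectors, and $\mathrm{range}(Z)$ the column space of $Z$. *)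

theory Defs
  imports "HOL-Analysis.L2_Norm" "Jordan_Normal_Form.Schur_Decomposition"
begin

definition vnorm :: "complex vec \<Rightarrow> real" where
  "vnorm v = L2_set (\<lambda>i. cmod (v $ i)) {..<dim_vec v}"

definition unitary_mat :: "nat \<Rightarrow> complex mat \<Rightarrow> bool" where
  "unitary_mat p U \<longleftrightarrow> U \<in> carrier_mat p p \<and>
     mat_adjoint U * U = 1\<^sub>m p \<and> U * mat_adjoint U = 1\<^sub>m p"

text \<open>
  Rows and columns are numbered from 0, so the j-th singular value in the usual numbering
  is the entry of S at (j - 1, j - 1), and the j-th left and right singular vectors are the
  columns of index j - 1 of U and V. Singular vectors are not unique: any matrices
  satisfying the predicate form a full SVD.
\<close>

definition full_svd ::
  "nat \<Rightarrow> nat \<Rightarrow> complex mat \<Rightarrow> complex mat \<Rightarrow> real mat \<Rightarrow> complex mat \<Rightarrow> bool" where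
  "full_svd m n A U S V \<longleftrightarrow>
     A \<in> carrier_mat m n \<and> unitary_mat m U \<and> unitary_mat n V \<and>
     S \<in> carrier_mat m n \<and> diagonal_mat S \<and>
     (\<forall>j < min m n. 0 \<le> S $$ (j, j)) \<and>
     (\<forall>i j. i \<le> j \<and> j < min m n \<longrightarrow> S $$ (j, j) \<le> S $$ (i, i)) \<and>
     A = U * map_mat complex_of_real S * mat_adjoint V"

definition mat_range :: "complex mat \<Rightarrow> complex vec set" where
  "mat_range Z = vec_space.col_space (dim_row Z) Z"

definition Z_mat :: "nat \<Rightarrow> nat \<Rightarrow> nat \<Rightarrow> complex mat \<Rightarrow> complex mat" where
  "Z_mat m s k U =
     four_block_mat (mat_of_cols m (take k (cols U))) (0\<^sub>m m s)
                    (0\<^sub>m s k)                         (1\<^sub>m s)"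

end

theory Submission
  imports Defs
begin

text \<open>
  The bound holds with \<open>C = 1\<close>. Put \<open>A = B @\<^sub>r E\<close>, let \<open>u\<close> be the left singular vector
  of \<open>A\<close> under consideration, \<open>v\<close> the matching right singular vector and \<open>b\<close> their singular
  value, and split \<open>u\<close> into its first \<open>m\<close> entries \<open>x\<close> and its last \<open>s\<close> entries \<open>y\<close>.
  Since \<open>U\<close> is unitary, \<open>diag(U, I)\<close> is unitary too, and the range of \<open>Z\<close> is spanned by some
  of its columns. The best approximation of \<open>u\<close> from that range therefore drops exactly the
  coordinates \<open>p j = (U\<^sup>H x) j\<close> with \<open>k \<le> j\<close>, and the squared distance is the sum of their
  squared moduli (\<open>best_approximation_Z_mat\<close>).

  Let \<open>s j\<close> be the diagonal entries of \<open>S\<close>, and let \<open>q = V\<^sup>H v\<close> and \<open>e = V\<^sup>H (E\<^sup>H y)\<close>.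
  The first \<open>m\<close> rows of \<open>A v = b u\<close> say \<open>B v = b x\<close>, while \<open>A\<^sup>H u = b v\<close> says
  \<open>B\<^sup>H x + E\<^sup>H y = b v\<close>. In the singular bases of \<open>B\<close> these decouple into the scalar equations
  \<open>b p j = s j q j\<close> and \<open>s j p j + e j = b q j\<close>. Eliminating \<open>q j\<close> gives
  \<open>(b\<^sup>2 - (s j)\<^sup>2) p j = s j e j\<close> (\<open>left_singular_vector_coord\<close>); for \<open>n \<le> j\<close>
  only \<open>b p j = 0\<close> is left.

  Let \<open>a = s k\<close>. Adding rows does not decrease singular values, so \<open>a \<le> b\<close>
  (\<open>singular_value_append_rows_mono\<close>), and \<open>a \<noteq> b\<close> makes this strict. As
  \<open>t / (b\<^sup>2 - t\<^sup>2)\<close> increases with \<open>t\<close> on \<open>[0, b)\<close> and \<open>s j \<le> a\<close> for \<open>k \<le> j\<close>, each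
  such coordinate has modulus at most \<open>a / (b\<^sup>2 - a\<^sup>2)\<close> times that of \<open>e j\<close>. Summing squares
  and using that \<open>e\<close> has the norm of \<open>E\<^sup>H y\<close> finishes the proof (\<open>left_singular_vector_tail\<close>).
\<close>

section \<open>Adjoints and the Euclidean norm\<close>

lemma mat_adjoint_dim [simp]:
  "dim_row (mat_adjoint A) = dim_col A" "dim_col (mat_adjoint A) = dim_row A"
  unfolding mat_adjoint_def by auto

lemma mat_adjoint_carrier [simp]:
  "A \<in> carrier_mat m n \<Longrightarrow> mat_adjoint A \<in> carrier_mat n m"
  by (metis carrier_matD carrier_matI mat_adjoint_dim)

lemma mat_adjoint_index [simp]:
  fixes A :: "complex mat"
  assumes "i < dim_col A" "j < dim_row A"
  shows "mat_adjoint A $$ (i, j) = cnj (A $$ (j, i))"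
  using assms unfolding mat_adjoint_def by (simp add: mat_of_rows_index)

lemma mat_adjoint_adjoint [simp]:
  fixes A :: "complex mat"
  shows "mat_adjoint (mat_adjoint A) = A"
  by (rule eq_matI) auto

lemma mat_adjoint_mult:
  fixes A B :: "complex mat"
  assumes "A \<in> carrier_mat m n" "B \<in> carrier_mat n p"
  shows "mat_adjoint (A * B) = mat_adjoint B * mat_adjoint A"
  using assms by (intro eq_matI) (auto simp: scalar_prod_def mult.commute intro!: sum.cong)

lemma sum_lessThan_add:
  fixes f :: "nat \<Rightarrow> 'a :: comm_monoid_add"
  shows "(\<Sum>i<m + n. f i) = (\<Sum>i<m. f i) + (\<Sum>i<n. f (m + i))"
  by (induction n) (simp_all add: add.assoc)

lemma mult_mat_vec_index_sum:
  assumes "A \<in> carrier_mat m n" "v \<in> carrier_vec n" "i < m"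
  shows "(A *\<^sub>v v) $ i = (\<Sum>j<n. A $$ (i, j) * v $ j)"
  using assms by (auto simp: scalar_prod_def atLeast0LessThan intro!: sum.cong)

lemma mult_mat_unit_vec:
  fixes A :: "'a :: semiring_1 mat"
  assumes "A \<in> carrier_mat m n" "j < n"
  shows "A *\<^sub>v unit_vec n j = col A j"
  using assms by (intro eq_vecI) auto

lemma mat_adjoint_append_rows_mult_vec:
  fixes B E :: "complex mat"
  assumes B: "B \<in> carrier_mat m n" and E: "E \<in> carrier_mat s n"
    and x: "x \<in> carrier_vec m" and y: "y \<in> carrier_vec s"
  shows "mat_adjoint (B @\<^sub>r E) *\<^sub>v (x @\<^sub>v y) = mat_adjoint B *\<^sub>v x + mat_adjoint E *\<^sub>v y"
proof (rule eq_vecI)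
  have A: "B @\<^sub>r E \<in> carrier_mat (m + s) n" using B E by simp
  show "dim_vec (mat_adjoint (B @\<^sub>r E) *\<^sub>v (x @\<^sub>v y))
      = dim_vec (mat_adjoint B *\<^sub>v x + mat_adjoint E *\<^sub>v y)"
    using carrier_matD[OF A] B E by simp
  fix i assume "i < dim_vec (mat_adjoint B *\<^sub>v x + mat_adjoint E *\<^sub>v y)"
  hence i: "i < n" using E by simp
  have "(mat_adjoint (B @\<^sub>r E) *\<^sub>v (x @\<^sub>v y)) $ i
      = (\<Sum>j<m + s. mat_adjoint (B @\<^sub>r E) $$ (i, j) * (x @\<^sub>v y) $ j)"
    using A x y i by (intro mult_mat_vec_index_sum) auto
  also have "\<dots> = (\<Sum>j<m. mat_adjoint B $$ (i, j) * x $ j)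
      + (\<Sum>j<s. mat_adjoint E $$ (i, j) * y $ j)"
    using carrier_matD[OF A] B E x y i
    by (simp add: sum_lessThan_add append_rows_def)
  also have "\<dots> = (mat_adjoint B *\<^sub>v x + mat_adjoint E *\<^sub>v y) $ i"
    using B E x y i by (simp add: mult_mat_vec_index_sum[of _ n m] mult_mat_vec_index_sum[of _ n s]
      del: index_mult_mat_vec)
  finally show "(mat_adjoint (B @\<^sub>r E) *\<^sub>v (x @\<^sub>v y)) $ i
      = (mat_adjoint B *\<^sub>v x + mat_adjoint E *\<^sub>v y) $ i" .
qed

lemma vnorm_nonneg: "0 \<le> vnorm v"
  unfolding vnorm_def by (rule L2_set_nonneg)

lemma vnorm_power2: "(vnorm v)\<^sup>2 = (\<Sum>i<dim_vec v. (cmod (v $ i))\<^sup>2)"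
  unfolding vnorm_def L2_set_def by (simp add: sum_nonneg)

lemma vnorm_append_power2: "(vnorm (x @\<^sub>v y))\<^sup>2 = (vnorm x)\<^sup>2 + (vnorm y)\<^sup>2"
  by (simp add: vnorm_power2 sum_lessThan_add)

lemma vnorm_power2_cscalar_prod: "complex_of_real ((vnorm v)\<^sup>2) = v \<bullet>c v"
  by (simp add: vnorm_power2 scalar_prod_def atLeast0LessThan complex_norm_square del: of_real_power)

lemma cscalar_prod_mat_adjoint:
  fixes A :: "complex mat"
  assumes A: "A \<in> carrier_mat m n" and v: "v \<in> carrier_vec n" and w: "w \<in> carrier_vec m"
  shows "(A *\<^sub>v v) \<bullet>c w = v \<bullet>c (mat_adjoint A *\<^sub>v w)"
proof -
  have "(A *\<^sub>v v) \<bullet>c w = (\<Sum>i<m. \<Sum>j<n. A $$ (i, j) * v $ j * cnj (w $ i))"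
    using A v w by (simp add: scalar_prod_def atLeast0LessThan sum_distrib_right)
  also have "\<dots> = (\<Sum>j<n. \<Sum>i<m. A $$ (i, j) * v $ j * cnj (w $ i))"
    by (rule sum.swap)
  also have "\<dots> = v \<bullet>c (mat_adjoint A *\<^sub>v w)"
    using A v w by (simp add: scalar_prod_def atLeast0LessThan sum_distrib_left ac_simps)
  finally show ?thesis .
qed

section \<open>Unitary matrices\<close>

lemma unitary_mat_carrier: "unitary_mat p U \<Longrightarrow> U \<in> carrier_mat p p"
  unfolding unitary_mat_def by blast

lemma unitary_mat_adjoint: "unitary_mat p U \<Longrightarrow> unitary_mat p (mat_adjoint U)"
  unfolding unitary_mat_def by simp

lemma unitary_mat_adjoint_cancel:
  assumes U: "unitary_mat p U" and v: "v \<in> carrier_vec p"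
  shows "mat_adjoint U *\<^sub>v (U *\<^sub>v v) = v"
proof -
  have "mat_adjoint U *\<^sub>v (U *\<^sub>v v) = (mat_adjoint U * U) *\<^sub>v v"
    using unitary_mat_carrier[OF U] v by (intro assoc_mult_mat_vec[symmetric]) auto
  thus ?thesis using U v unfolding unitary_mat_def by simp
qed

lemma unitary_mat_cancel_adjoint:
  assumes "unitary_mat p U" and "v \<in> carrier_vec p"
  shows "U *\<^sub>v (mat_adjoint U *\<^sub>v v) = v"
  using unitary_mat_adjoint_cancel[OF unitary_mat_adjoint[OF assms(1)] assms(2)] by simp

lemma vnorm_unitary:
  assumes U: "unitary_mat p U" and v: "v \<in> carrier_vec p"
  shows "vnorm (U *\<^sub>v v) = vnorm v"
proof -
  have "complex_of_real ((vnorm (U *\<^sub>v v))\<^sup>2) = v \<bullet>c (mat_adjoint U *\<^sub>v (U *\<^sub>v v))"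
    using unitary_mat_carrier[OF U] v
    by (simp only: vnorm_power2_cscalar_prod) (intro cscalar_prod_mat_adjoint, auto)
  also have "\<dots> = complex_of_real ((vnorm v)\<^sup>2)"
    by (simp only: unitary_mat_adjoint_cancel[OF U v] vnorm_power2_cscalar_prod)
  finally have "(vnorm (U *\<^sub>v v))\<^sup>2 = (vnorm v)\<^sup>2" by (simp only: of_real_eq_iff)
  thus ?thesis by (simp add: vnorm_nonneg)
qed

lemma vnorm_adjoint_unitary_power2:
  assumes U: "unitary_mat p U" and v: "v \<in> carrier_vec p"
  shows "(vnorm v)\<^sup>2 = (\<Sum>j<p. (cmod ((mat_adjoint U *\<^sub>v v) $ j))\<^sup>2)"
proof -
  have "(vnorm v)\<^sup>2 = (vnorm (mat_adjoint U *\<^sub>v v))\<^sup>2"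
    using vnorm_unitary[OF unitary_mat_adjoint[OF U] v] by simp
  thus ?thesis using unitary_mat_carrier[OF U] by (simp add: vnorm_power2)
qed

section \<open>Action of a matrix in its singular bases\<close>

lemma diagonal_mat_mult_vec_index:
  fixes S :: "real mat" and q :: "complex vec"
  assumes S: "S \<in> carrier_mat m n" "diagonal_mat S" and q: "q \<in> carrier_vec n" and j: "j < m"
  shows "(map_mat complex_of_real S *\<^sub>v q) $ j = (if j < n then S $$ (j, j) * q $ j else 0)"
proof -
  have "(map_mat complex_of_real S *\<^sub>v q) $ j = (\<Sum>l<n. map_mat complex_of_real S $$ (j, l) * q $ l)"
    using S q j by (intro mult_mat_vec_index_sum) auto
  also have "\<dots> = (\<Sum>l<n. if l = j then S $$ (j, j) * q $ j else 0)"
    using S j unfolding diagonal_mat_def by (intro sum.cong) auto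
  also have "\<dots> = (if j < n then S $$ (j, j) * q $ j else 0)" by (simp add: sum.delta)
  finally show ?thesis .
qed

lemma full_svd_mult_vec:
  assumes svd: "full_svd m n A U S V" and w: "w \<in> carrier_vec n"
  shows "A *\<^sub>v w = U *\<^sub>v (map_mat complex_of_real S *\<^sub>v (mat_adjoint V *\<^sub>v w))"
proof -
  have U: "U \<in> carrier_mat m m" and V: "mat_adjoint V \<in> carrier_mat n n"
    and S: "map_mat complex_of_real S \<in> carrier_mat m n"
    and A: "A = U * map_mat complex_of_real S * mat_adjoint V"
    using svd unfolding full_svd_def unitary_mat_def by auto
  have "A *\<^sub>v w = (U * map_mat complex_of_real S) *\<^sub>v (mat_adjoint V *\<^sub>v w)"
    unfolding A using U V S w by (intro assoc_mult_mat_vec) auto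
  also have "\<dots> = U *\<^sub>v (map_mat complex_of_real S *\<^sub>v (mat_adjoint V *\<^sub>v w))"
    using U V S w by (intro assoc_mult_mat_vec) auto
  finally show ?thesis .
qed

text \<open>In the bases given by the columns of \<open>V\<close> and \<open>U\<close> the matrix acts diagonally. When
  \<open>n < m\<close>, the rows of \<open>S\<close> from \<open>n\<close> on vanish, hence the second alternative.\<close>

lemma full_svd_coord:
  assumes svd: "full_svd m n A U S V" and w: "w \<in> carrier_vec n" and j: "j < m"
  shows "(mat_adjoint U *\<^sub>v (A *\<^sub>v w)) $ j
      = (if j < n then S $$ (j, j) * (mat_adjoint V *\<^sub>v w) $ j else 0)"
proof -
  have U: "unitary_mat m U" and V: "V \<in> carrier_mat n n"
    and S: "S \<in> carrier_mat m n" "diagonal_mat S"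
    using svd unfolding full_svd_def unitary_mat_def by auto
  have "mat_adjoint U *\<^sub>v (A *\<^sub>v w) = map_mat complex_of_real S *\<^sub>v (mat_adjoint V *\<^sub>v w)"
    unfolding full_svd_mult_vec[OF svd w]
    using S V w by (intro unitary_mat_adjoint_cancel[OF U] mult_mat_vec_carrier) auto
  moreover have "mat_adjoint V *\<^sub>v w \<in> carrier_vec n"
    using V w by (intro mult_mat_vec_carrier) auto
  ultimately show ?thesis using diagonal_mat_mult_vec_index[OF S _ j] by simp
qed

text \<open>The symmetry of the decomposition under taking adjoints makes every statement about
  \<open>A\<close> and its right singular vectors available for the adjoint of \<open>A\<close> and the left
  singular vectors.\<close>

lemma full_svd_adjoint:
  assumes svd: "full_svd m n A U S V"
  shows "full_svd n m (mat_adjoint A) V (transpose_mat S) U"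
proof -
  have U: "U \<in> carrier_mat m m" and V: "V \<in> carrier_mat n n"
    and S: "S \<in> carrier_mat m n" "diagonal_mat S"
    and A: "A = U * map_mat complex_of_real S * mat_adjoint V"
    using svd unfolding full_svd_def unitary_mat_def by auto
  let ?T = "map_mat complex_of_real S"
  have T: "?T \<in> carrier_mat m n" using S by simp
  have eq: "mat_adjoint ?T = map_mat complex_of_real (transpose_mat S)"
    by (rule eq_matI) auto
  have "mat_adjoint A = V * mat_adjoint (U * ?T)"
    unfolding A using U V T by (subst mat_adjoint_mult[of _ m n _ n]) auto
  also have "\<dots> = V * (mat_adjoint ?T * mat_adjoint U)"
    using U T by (subst mat_adjoint_mult[of _ m m _ n]) auto
  also have "\<dots> = V * mat_adjoint ?T * mat_adjoint U"
    using U V T by (intro assoc_mult_mat[symmetric]) auto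
  finally have "mat_adjoint A = V * map_mat complex_of_real (transpose_mat S) * mat_adjoint U"
    unfolding eq .
  moreover have "diagonal_mat (transpose_mat S)"
    using S unfolding diagonal_mat_def by auto
  moreover have "mat_adjoint A \<in> carrier_mat n m"
    using svd unfolding full_svd_def by (intro mat_adjoint_carrier) blast
  ultimately show ?thesis using svd S unfolding full_svd_def by auto
qed

lemma full_svd_right_vector:
  assumes svd: "full_svd m n A U S V" and i: "i < min m n"
  shows "A *\<^sub>v col V i = complex_of_real (S $$ (i, i)) \<cdot>\<^sub>v col U i"
proof -
  have U: "unitary_mat m U" and V: "unitary_mat n V"
    and S: "S \<in> carrier_mat m n" "diagonal_mat S"
    using svd unfolding full_svd_def by auto
  have Uc: "U \<in> carrier_mat m m" and Vc: "V \<in> carrier_mat n n"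
    using U V unitary_mat_carrier by auto
  have e: "mat_adjoint V *\<^sub>v col V i = unit_vec n i"
    using unitary_mat_adjoint_cancel[OF V unit_vec_carrier, of i] mult_mat_unit_vec[OF Vc, of i] i
    by simp
  have d: "map_mat complex_of_real S *\<^sub>v unit_vec n i = complex_of_real (S $$ (i, i)) \<cdot>\<^sub>v unit_vec m i"
    using S i
    by (intro eq_vecI) (auto simp: diagonal_mat_mult_vec_index[OF S] simp del: index_mult_mat_vec)
  have "col V i \<in> carrier_vec n" using Vc by (intro carrier_vecI) simp
  hence "A *\<^sub>v col V i = U *\<^sub>v (complex_of_real (S $$ (i, i)) \<cdot>\<^sub>v unit_vec m i)"
    using full_svd_mult_vec[OF svd, of "col V i"] Vc i by (simp add: e d)
  also have "\<dots> = complex_of_real (S $$ (i, i)) \<cdot>\<^sub>v (U *\<^sub>v unit_vec m i)"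
    using Uc by (intro mult_mat_vec) auto
  finally show ?thesis using mult_mat_unit_vec[OF Uc] i by simp
qed

lemma full_svd_left_vector:
  assumes svd: "full_svd m n A U S V" and i: "i < min m n"
  shows "mat_adjoint A *\<^sub>v col U i = complex_of_real (S $$ (i, i)) \<cdot>\<^sub>v col V i"
proof -
  have "S \<in> carrier_mat m n" using svd unfolding full_svd_def by simp
  thus ?thesis using full_svd_right_vector[OF full_svd_adjoint[OF svd], of i] i by simp
qed

section \<open>Adding rows does not decrease singular values\<close>

text \<open>The next two estimates are the halves of the Courant-Fischer principle: all stretching
  factors on the first \<open>r + 1\<close> right singular directions are at least the singular value of
  index \<open>r\<close>, and all those on the directions of index at least \<open>r\<close> are at most that value.\<close>

lemma full_svd_vnorm_lower:
  assumes svd: "full_svd m n A U S V" and r: "r < min m n" and w: "w \<in> carrier_vec n"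
    and supp: "\<And>j. r < j \<Longrightarrow> j < n \<Longrightarrow> (mat_adjoint V *\<^sub>v w) $ j = 0"
  shows "S $$ (r, r) * vnorm w \<le> vnorm (A *\<^sub>v w)"
proof (rule power2_le_imp_le)
  let ?q = "mat_adjoint V *\<^sub>v w"
  have U: "unitary_mat m U" and V: "unitary_mat n V" and A: "A \<in> carrier_mat m n"
    using svd unfolding full_svd_def by auto
  have mono: "\<And>i j. i \<le> j \<Longrightarrow> j < min m n \<Longrightarrow> S $$ (j, j) \<le> S $$ (i, i)"
    and nn: "0 \<le> S $$ (r, r)"
    using svd r unfolding full_svd_def by auto
  have "(S $$ (r, r) * vnorm w)\<^sup>2 = (\<Sum>j<n. (S $$ (r, r))\<^sup>2 * (cmod (?q $ j))\<^sup>2)"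
    by (simp add: power_mult_distrib vnorm_adjoint_unitary_power2[OF V w] sum_distrib_left
        del: index_mult_mat_vec)
  also have "\<dots> = (\<Sum>j\<le>r. (S $$ (r, r))\<^sup>2 * (cmod (?q $ j))\<^sup>2)"
    using r supp by (intro sum.mono_neutral_right) (auto simp del: index_mult_mat_vec)
  also have "\<dots> \<le> (\<Sum>j\<le>r. (cmod ((mat_adjoint U *\<^sub>v (A *\<^sub>v w)) $ j))\<^sup>2)"
  proof (rule sum_mono)
    fix j assume "j \<in> {..r}"
    hence j: "j \<le> r" "j < m" "j < n" using r by auto
    have "(S $$ (r, r))\<^sup>2 \<le> (S $$ (j, j))\<^sup>2" using mono[OF j(1) r] nn by (rule power_mono)
    thus "(S $$ (r, r))\<^sup>2 * (cmod (?q $ j))\<^sup>2 \<le> (cmod ((mat_adjoint U *\<^sub>v (A *\<^sub>v w)) $ j))\<^sup>2"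
      using j by (simp add: full_svd_coord[OF svd w j(2)] norm_mult power_mult_distrib
          mult_right_mono del: index_mult_mat_vec)
  qed
  also have "\<dots> \<le> (\<Sum>j<m. (cmod ((mat_adjoint U *\<^sub>v (A *\<^sub>v w)) $ j))\<^sup>2)"
    using r by (intro sum_mono2) auto
  also have "\<dots> = (vnorm (A *\<^sub>v w))\<^sup>2"
    using A w by (intro vnorm_adjoint_unitary_power2[OF U, symmetric] mult_mat_vec_carrier)
  finally show "(S $$ (r, r) * vnorm w)\<^sup>2 \<le> (vnorm (A *\<^sub>v w))\<^sup>2" .
qed (rule vnorm_nonneg)

lemma full_svd_vnorm_upper:
  assumes svd: "full_svd m n A U S V" and r: "r < min m n" and w: "w \<in> carrier_vec n"
    and supp: "\<And>j. j < r \<Longrightarrow> (mat_adjoint V *\<^sub>v w) $ j = 0"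
  shows "vnorm (A *\<^sub>v w) \<le> S $$ (r, r) * vnorm w"
proof (rule power2_le_imp_le)
  let ?q = "mat_adjoint V *\<^sub>v w"
  have U: "unitary_mat m U" and V: "unitary_mat n V" and A: "A \<in> carrier_mat m n"
    using svd unfolding full_svd_def by auto
  have mono: "\<And>i j. i \<le> j \<Longrightarrow> j < min m n \<Longrightarrow> S $$ (j, j) \<le> S $$ (i, i)"
    and nn: "\<And>j. j < min m n \<Longrightarrow> 0 \<le> S $$ (j, j)"
    using svd unfolding full_svd_def by auto
  have "(vnorm (A *\<^sub>v w))\<^sup>2 = (\<Sum>j<m. (cmod ((mat_adjoint U *\<^sub>v (A *\<^sub>v w)) $ j))\<^sup>2)"
    using A w by (intro vnorm_adjoint_unitary_power2[OF U] mult_mat_vec_carrier)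
  also have "\<dots> \<le> (\<Sum>j<m. if j < n then (S $$ (r, r))\<^sup>2 * (cmod (?q $ j))\<^sup>2 else 0)"
  proof (rule sum_mono)
    fix j assume "j \<in> {..<m}"
    hence j: "j < m" by simp
    show "(cmod ((mat_adjoint U *\<^sub>v (A *\<^sub>v w)) $ j))\<^sup>2
        \<le> (if j < n then (S $$ (r, r))\<^sup>2 * (cmod (?q $ j))\<^sup>2 else 0)"
    proof (cases "r \<le> j \<and> j < n")
      case True
      hence "(S $$ (j, j))\<^sup>2 \<le> (S $$ (r, r))\<^sup>2"
        using mono[of r j] nn[of j] j by (intro power_mono) auto
      thus ?thesis using True
        by (simp add: full_svd_coord[OF svd w j] norm_mult power_mult_distrib
            mult_right_mono del: index_mult_mat_vec)
    next
      case False
      thus ?thesis using supp[of j]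
        by (auto simp: full_svd_coord[OF svd w j] simp del: index_mult_mat_vec)
    qed
  qed
  also have "\<dots> = (\<Sum>j\<in>{..<m} \<inter> {..<n}. (S $$ (r, r))\<^sup>2 * (cmod (?q $ j))\<^sup>2)"
    by (simp add: sum.inter_restrict)
  also have "\<dots> \<le> (\<Sum>j<n. (S $$ (r, r))\<^sup>2 * (cmod (?q $ j))\<^sup>2)"
    by (intro sum_mono2) auto
  also have "\<dots> = (S $$ (r, r) * vnorm w)\<^sup>2"
    by (simp add: power_mult_distrib vnorm_adjoint_unitary_power2[OF V w] sum_distrib_left
        del: index_mult_mat_vec)
  finally show "(vnorm (A *\<^sub>v w))\<^sup>2 \<le> (S $$ (r, r) * vnorm w)\<^sup>2" .
qed (use svd r in \<open>auto simp: full_svd_def vnorm_nonneg\<close>)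

text \<open>A dimension count: \<open>r\<close> homogeneous equations in \<open>r + 1\<close> unknowns have a nonzero
  solution. Padding the system with a zero row makes it square with zero determinant.\<close>

lemma exists_nonzero_in_intersection:
  fixes W :: "complex mat"
  assumes W: "W \<in> carrier_mat n n" and r: "r < n"
  shows "\<exists>d\<in>carrier_vec n. d \<noteq> 0\<^sub>v n \<and> (\<forall>j. r < j \<longrightarrow> j < n \<longrightarrow> d $ j = 0)
      \<and> (\<forall>l<r. (W *\<^sub>v d) $ l = 0)"
proof -
  define G where "G = mat (Suc r) (Suc r) (\<lambda>(l, j). if l < r then W $$ (l, j) else 0)"
  have G: "G \<in> carrier_mat (Suc r) (Suc r)" unfolding G_def by simp
  have "det G = (\<Sum>j<Suc r. G $$ (r, j) * cofactor G r j)"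
    by (rule laplace_expansion_row[OF G]) simp
  also have "\<dots> = 0" unfolding G_def by (intro sum.neutral) auto
  finally have "det G = 0" .
  then obtain c where c: "c \<in> carrier_vec (Suc r)" "c \<noteq> 0\<^sub>v (Suc r)" "G *\<^sub>v c = 0\<^sub>v (Suc r)"
    using det_0_iff_vec_prod_zero[OF G] by auto
  define d where "d = vec n (\<lambda>j. if j \<le> r then c $ j else 0)"
  have d: "d \<in> carrier_vec n" unfolding d_def by simp
  have "d \<noteq> 0\<^sub>v n"
  proof
    assume d0: "d = 0\<^sub>v n"
    have "c = 0\<^sub>v (Suc r)"
    proof (rule eq_vecI)
      fix j assume "j < dim_vec (0\<^sub>v (Suc r) :: complex vec)"
      hence j: "j \<le> r" by simp
      hence "c $ j = d $ j" using r unfolding d_def by simp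
      thus "c $ j = 0\<^sub>v (Suc r) $ j" using j r by (simp add: d0)
    qed (use c in simp)
    thus False using c by simp
  qed
  moreover have "(W *\<^sub>v d) $ l = 0" if l: "l < r" for l
  proof -
    have "(W *\<^sub>v d) $ l = (\<Sum>j<n. W $$ (l, j) * d $ j)"
      using W d l r by (intro mult_mat_vec_index_sum[of _ n]) auto
    also have "\<dots> = (\<Sum>j<Suc r. W $$ (l, j) * d $ j)"
      using r by (intro sum.mono_neutral_right) (auto simp: d_def)
    also have "\<dots> = (\<Sum>j<Suc r. G $$ (l, j) * c $ j)"
      using r l by (intro sum.cong) (auto simp: d_def G_def)
    also have "\<dots> = (G *\<^sub>v c) $ l"
      using l by (intro mult_mat_vec_index_sum[OF G c(1), symmetric]) simp
    finally show ?thesis using c l by simp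
  qed
  ultimately show ?thesis using d by (intro bexI[of _ d]) (auto simp: d_def)
qed

text \<open>By the dimension count there is a nonzero \<open>w\<close> that lies in the span of the first
  \<open>r + 1\<close> right singular vectors of \<open>B\<close> and is orthogonal to the first \<open>r\<close> of the extended
  matrix. Both estimates above then apply to \<open>w\<close>, and they are linked by the fact that the
  image of \<open>w\<close> under \<open>B\<close> is a part of its image under the extended matrix.\<close>

lemma singular_value_append_rows_mono:
  assumes svd: "full_svd m n B U S V" and E: "E \<in> carrier_mat s n"
    and svd': "full_svd (m + s) n (B @\<^sub>r E) U' S' V'" and r: "r < min m n"
  shows "S $$ (r, r) \<le> S' $$ (r, r)"
proof -
  have V: "unitary_mat n V" and V': "unitary_mat n V'" and B: "B \<in> carrier_mat m n"
    using svd svd' unfolding full_svd_def by auto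
  have Vc: "V \<in> carrier_mat n n" and V'c: "V' \<in> carrier_mat n n"
    using V V' unitary_mat_carrier by auto
  obtain d where d: "d \<in> carrier_vec n" "d \<noteq> 0\<^sub>v n"
      "\<And>j. r < j \<Longrightarrow> j < n \<Longrightarrow> d $ j = 0" "\<And>l. l < r \<Longrightarrow> ((mat_adjoint V' * V) *\<^sub>v d) $ l = 0"
    using exists_nonzero_in_intersection[of "mat_adjoint V' * V" n r]
      mult_carrier_mat[OF mat_adjoint_carrier[OF V'c] Vc] r
    by (auto simp del: index_mult_mat_vec)
  define w where "w = V *\<^sub>v d"
  have w: "w \<in> carrier_vec n" unfolding w_def using Vc d(1) by simp
  have Vw: "mat_adjoint V *\<^sub>v w = d"
    unfolding w_def by (rule unitary_mat_adjoint_cancel[OF V d(1)])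
  have V'w: "mat_adjoint V' *\<^sub>v w = (mat_adjoint V' * V) *\<^sub>v d"
    unfolding w_def using Vc V'c d(1) by (intro assoc_mult_mat_vec[symmetric]) auto
  have "vnorm d \<noteq> 0"
  proof
    assume "vnorm d = 0"
    hence "(\<Sum>j<n. (cmod (d $ j))\<^sup>2) = 0" using vnorm_power2[of d] d(1) by simp
    hence "\<And>j. j < n \<Longrightarrow> d $ j = 0" by (simp add: sum_nonneg_eq_0_iff)
    hence "d = 0\<^sub>v n" using d(1) by (intro eq_vecI) auto
    thus False using d(2) by simp
  qed
  hence pos: "0 < vnorm w" unfolding w_def vnorm_unitary[OF V d(1)]
    using vnorm_nonneg[of d] by linarith
  have "S $$ (r, r) * vnorm w \<le> vnorm (B *\<^sub>v w)"
    using d(3) by (intro full_svd_vnorm_lower[OF svd r w]) (simp add: Vw)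
  also have "\<dots> \<le> vnorm ((B @\<^sub>r E) *\<^sub>v w)"
    by (rule power2_le_imp_le) (auto simp: mat_mult_append[OF B E w] vnorm_append_power2 vnorm_nonneg)
  also have "\<dots> \<le> S' $$ (r, r) * vnorm w"
    using r d(4) by (intro full_svd_vnorm_upper[OF svd' _ w]) (auto simp: V'w simp del: index_mult_mat_vec)
  finally show ?thesis using pos by simp
qed

section \<open>The range of the augmented basis\<close>

lemma leading_cols_mult_vec:
  assumes U: "U \<in> carrier_mat m m" and k: "k \<le> m" and c: "c \<in> carrier_vec k"
  shows "mat_of_cols m (take k (cols U)) *\<^sub>v c = U *\<^sub>v (c @\<^sub>v 0\<^sub>v (m - k))"
proof (rule eq_vecI)
  let ?M = "mat_of_cols m (take k (cols U))"
  have M: "?M \<in> carrier_mat m k" using mat_of_cols_carrier(1)[of m "take k (cols U)"] carrier_matD[OF U] k by simp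
  have c0: "c @\<^sub>v 0\<^sub>v (m - k) \<in> carrier_vec m" using c k by (intro carrier_vecI) simp
  fix i assume "i < dim_vec (U *\<^sub>v (c @\<^sub>v 0\<^sub>v (m - k)))"
  hence i: "i < m" using U by simp
  have "(?M *\<^sub>v c) $ i = (\<Sum>j<k. ?M $$ (i, j) * c $ j)"
    by (rule mult_mat_vec_index_sum[OF M c i])
  also have "\<dots> = (\<Sum>j<k. U $$ (i, j) * (c @\<^sub>v 0\<^sub>v (m - k)) $ j)"
    using U k c i by (intro sum.cong) (auto simp: mat_of_cols_index)
  also have "\<dots> = (\<Sum>j<m. U $$ (i, j) * (c @\<^sub>v 0\<^sub>v (m - k)) $ j)"
    using k c by (intro sum.mono_neutral_left) auto
  also have "\<dots> = (U *\<^sub>v (c @\<^sub>v 0\<^sub>v (m - k))) $ i"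
    by (rule mult_mat_vec_index_sum[OF U c0 i, symmetric])
  finally show "(?M *\<^sub>v c) $ i = (U *\<^sub>v (c @\<^sub>v 0\<^sub>v (m - k))) $ i" .
qed (use U in simp)

text \<open>Describing the range by the vanishing of coordinates, rather than by generators, turns
  the approximation problem below into one about independent coordinates.\<close>

lemma mat_range_Z_mat:
  assumes U: "unitary_mat m U" and k: "k \<le> m"
  shows "mat_range (Z_mat m s k U) = {w1 @\<^sub>v w2 | w1 w2. w1 \<in> carrier_vec m \<and> w2 \<in> carrier_vec s
    \<and> (\<forall>j. k \<le> j \<longrightarrow> j < m \<longrightarrow> (mat_adjoint U *\<^sub>v w1) $ j = 0)}" (is "_ = ?R")
proof -
  let ?M = "mat_of_cols m (take k (cols U))"
  let ?Z = "Z_mat m s k U"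
  have Uc: "U \<in> carrier_mat m m" by (rule unitary_mat_carrier[OF U])
  have M: "?M \<in> carrier_mat m k" using mat_of_cols_carrier(1)[of m "take k (cols U)"] carrier_matD[OF Uc] k by simp
  have Z: "?Z \<in> carrier_mat (m + s) (k + s)" unfolding Z_mat_def using M by simp
  have range: "mat_range ?Z = {y \<in> carrier_vec (m + s). \<exists>x\<in>carrier_vec (k + s). ?Z *\<^sub>v x = y}"
    unfolding mat_range_def using vec_space.col_space_eq[OF Z] Z by simp
  have mult: "?Z *\<^sub>v (c @\<^sub>v e) = (U *\<^sub>v (c @\<^sub>v 0\<^sub>v (m - k))) @\<^sub>v e"
    if c: "c \<in> carrier_vec k" and e: "e \<in> carrier_vec s" for c e
    unfolding Z_mat_def using M c e Uc
    by (subst four_block_mat_mult_vec[OF M _ _ _ c e])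
      (auto simp: leading_cols_mult_vec[OF Uc k c, symmetric])
  have pad: "c @\<^sub>v 0\<^sub>v (m - k) \<in> carrier_vec m" if "c \<in> carrier_vec k" for c :: "complex vec"
    using that k by (intro carrier_vecI) simp
  show ?thesis
  proof (intro equalityI subsetI)
    fix w assume "w \<in> mat_range ?Z"
    then obtain x where x: "x \<in> carrier_vec (k + s)" and w: "w = ?Z *\<^sub>v x"
      unfolding range by auto
    let ?c = "vec_first x k" and ?e = "vec_last x s"
    have "w = (U *\<^sub>v (?c @\<^sub>v 0\<^sub>v (m - k))) @\<^sub>v ?e"
      using mult[of ?c ?e] x w by simp
    moreover have "mat_adjoint U *\<^sub>v (U *\<^sub>v (?c @\<^sub>v 0\<^sub>v (m - k))) = ?c @\<^sub>v 0\<^sub>v (m - k)"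
      by (intro unitary_mat_adjoint_cancel[OF U] pad) simp
    moreover have "(?c @\<^sub>v 0\<^sub>v (m - k)) $ j = 0" if "k \<le> j" "j < m" for j
      using that by simp
    moreover have "U *\<^sub>v (?c @\<^sub>v 0\<^sub>v (m - k)) \<in> carrier_vec m"
      by (intro mult_mat_vec_carrier[OF Uc] pad) simp
    ultimately show "w \<in> ?R"
      by (intro CollectI exI[of _ "U *\<^sub>v (?c @\<^sub>v 0\<^sub>v (m - k))"] exI[of _ ?e])
        (simp del: index_mult_mat_vec)
  next
    fix w assume "w \<in> ?R"
    then obtain w1 w2 where w: "w = w1 @\<^sub>v w2" "w1 \<in> carrier_vec m" "w2 \<in> carrier_vec s"
      and z: "\<And>j. k \<le> j \<Longrightarrow> j < m \<Longrightarrow> (mat_adjoint U *\<^sub>v w1) $ j = 0" by auto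
    let ?p = "mat_adjoint U *\<^sub>v w1"
    have p: "?p \<in> carrier_vec m" using Uc w(2) by (intro mult_mat_vec_carrier) auto
    have "vec_first ?p k @\<^sub>v 0\<^sub>v (m - k) = ?p"
      using carrier_vecD[OF p] k z
      by (intro eq_vecI) (auto simp: vec_first_def simp del: index_mult_mat_vec dim_mult_mat_vec)
    hence "?Z *\<^sub>v (vec_first ?p k @\<^sub>v w2) = w"
      using mult[of "vec_first ?p k" w2] w unitary_mat_cancel_adjoint[OF U w(2)] by simp
    thus "w \<in> mat_range ?Z" unfolding range
      using w by (auto intro!: bexI[of _ "vec_first ?p k @\<^sub>v w2"])
  qed
qed

text \<open>In the orthonormal coordinates given by \<open>diag(U, I)\<close> the elements of the range are free
  except in positions \<open>k, \<dots>, m - 1\<close>, where they vanish. So the error in those positions is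
  the same for all of them, and the minimizer copies every other coordinate of \<open>u\<close>.\<close>

lemma best_approximation_Z_mat:
  assumes U: "unitary_mat m U" and k: "k \<le> m" and u: "u \<in> carrier_vec (m + s)"
  shows "\<exists>z\<in>mat_range (Z_mat m s k U).
      (\<forall>w\<in>mat_range (Z_mat m s k U). vnorm (u - z) \<le> vnorm (u - w)) \<and>
      (vnorm (u - z))\<^sup>2 = (\<Sum>j=k..<m. (cmod ((mat_adjoint U *\<^sub>v vec_first u m) $ j))\<^sup>2)"
proof -
  define x where "x = vec_first u m"
  define y where "y = vec_last u s"
  define p where "p = mat_adjoint U *\<^sub>v x"
  define p0 where "p0 = vec m (\<lambda>j. if j < k then p $ j else 0)"
  define z1 where "z1 = U *\<^sub>v p0"
  have Uc: "U \<in> carrier_mat m m" by (rule unitary_mat_carrier[OF U])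
  have x: "x \<in> carrier_vec m" and y: "y \<in> carrier_vec s" unfolding x_def y_def by simp_all
  have uxy: "u = x @\<^sub>v y" unfolding x_def y_def using u by simp
  have p0: "p0 \<in> carrier_vec m" unfolding p0_def by simp
  have z1: "z1 \<in> carrier_vec m" unfolding z1_def using Uc p0 by simp
  have Uz1: "mat_adjoint U *\<^sub>v z1 = p0"
    unfolding z1_def by (rule unitary_mat_adjoint_cancel[OF U p0])
  have dist: "(vnorm (u - (w1 @\<^sub>v w2)))\<^sup>2
      = (\<Sum>j<m. (cmod (p $ j - (mat_adjoint U *\<^sub>v w1) $ j))\<^sup>2) + (vnorm (y - w2))\<^sup>2"
    if w1: "w1 \<in> carrier_vec m" and w2: "w2 \<in> carrier_vec s" for w1 w2
  proof -
    have "u - (w1 @\<^sub>v w2) = (x - w1) @\<^sub>v (y - w2)"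
      unfolding uxy using x y w1 w2 by (intro eq_vecI) auto
    moreover have "mat_adjoint U *\<^sub>v (x - w1) = p - mat_adjoint U *\<^sub>v w1"
      unfolding p_def using Uc x w1 by (intro mult_minus_distrib_mat_vec) auto
    ultimately show ?thesis using Uc x w1
      by (simp add: vnorm_append_power2 vnorm_adjoint_unitary_power2[OF U, of "x - w1"]
          del: index_mult_mat_vec)
  qed
  have z: "z1 @\<^sub>v y \<in> mat_range (Z_mat m s k U)"
    unfolding mat_range_Z_mat[OF U k] using z1 y Uz1
    by (intro CollectI exI[of _ z1] exI[of _ y]) (simp add: p0_def del: index_mult_mat_vec)
  have "(vnorm (u - (z1 @\<^sub>v y)))\<^sup>2 = (\<Sum>j<m. (cmod (p $ j - p0 $ j))\<^sup>2)"
    using y by (simp only: dist[OF z1 y] Uz1) (simp add: vnorm_power2)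
  also have "\<dots> = (\<Sum>j=k..<m. (cmod (p $ j))\<^sup>2)"
    by (intro sum.mono_neutral_cong_right) (auto simp: p0_def)
  finally have nz: "(vnorm (u - (z1 @\<^sub>v y)))\<^sup>2 = (\<Sum>j=k..<m. (cmod (p $ j))\<^sup>2)" .
  have "vnorm (u - (z1 @\<^sub>v y)) \<le> vnorm (u - w)" if "w \<in> mat_range (Z_mat m s k U)" for w
  proof (rule power2_le_imp_le)
    from that obtain w1 w2 where w: "w = w1 @\<^sub>v w2" "w1 \<in> carrier_vec m" "w2 \<in> carrier_vec s"
      and w0: "\<And>j. k \<le> j \<Longrightarrow> j < m \<Longrightarrow> (mat_adjoint U *\<^sub>v w1) $ j = 0"
      unfolding mat_range_Z_mat[OF U k] by auto
    have "(\<Sum>j=k..<m. (cmod (p $ j))\<^sup>2)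
        = (\<Sum>j=k..<m. (cmod (p $ j - (mat_adjoint U *\<^sub>v w1) $ j))\<^sup>2)"
      using w0 by (intro sum.cong) (auto simp del: index_mult_mat_vec)
    also have "\<dots> \<le> (\<Sum>j<m. (cmod (p $ j - (mat_adjoint U *\<^sub>v w1) $ j))\<^sup>2)"
      by (intro sum_mono2) auto
    also have "\<dots> \<le> (vnorm (u - w))\<^sup>2"
      unfolding w(1) dist[OF w(2,3)] by simp
    finally show "(vnorm (u - (z1 @\<^sub>v y)))\<^sup>2 \<le> (vnorm (u - w))\<^sup>2" unfolding nz .
  qed (rule vnorm_nonneg)
  thus ?thesis using z nz unfolding p_def x_def by blast
qed

section \<open>Size of the trailing coordinates\<close>

text \<open>Working with the pair of first-order singular vector equations, instead of the
  eigenvector equation for the product of the extended matrix with its adjoint, leaves two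
  scalar equations per index; the coordinate \<open>q\<close> of the right singular vector is then
  eliminated between them. A row index \<open>j\<close> with \<open>n \<le> j\<close> has no right singular vector, and
  only the first equation, with right-hand side zero, remains.\<close>

lemma left_singular_vector_coord:
  assumes svd: "full_svd m n B U S V" and E: "E \<in> carrier_mat s n"
    and svd': "full_svd (m + s) n (B @\<^sub>r E) U' S' V'" and i: "i < min (m + s) n"
    and j: "j < m"
  defines "p \<equiv> mat_adjoint U *\<^sub>v vec_first (col U' i) m"
    and "e \<equiv> mat_adjoint V *\<^sub>v (mat_adjoint E *\<^sub>v vec_last (col U' i) s)"
  shows "j < n \<Longrightarrow> ((S' $$ (i, i))\<^sup>2 - (S $$ (j, j))\<^sup>2) * p $ j = S $$ (j, j) * e $ j"
    and "\<not> j < n \<Longrightarrow> S' $$ (i, i) * p $ j = 0"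
proof -
  define x where "x = vec_first (col U' i) m"
  define y where "y = vec_last (col U' i) s"
  define v where "v = col V' i"
  define sh where "sh = complex_of_real (S' $$ (i, i))"
  define q where "q = mat_adjoint V *\<^sub>v v"
  have B: "B \<in> carrier_mat m n" and U: "U \<in> carrier_mat m m" and V: "V \<in> carrier_mat n n"
    and S: "S \<in> carrier_mat m n"
    and U': "U' \<in> carrier_mat (m + s) (m + s)" and V': "V' \<in> carrier_mat n n"
    using svd svd' unfolding full_svd_def unitary_mat_def by auto
  have x: "x \<in> carrier_vec m" and y: "y \<in> carrier_vec s" unfolding x_def y_def by simp_all
  have v: "v \<in> carrier_vec n" unfolding v_def using V' by (intro carrier_vecI) simp
  have "col U' i \<in> carrier_vec (m + s)" using U' by (intro carrier_vecI) simp
  hence u: "col U' i = x @\<^sub>v y" unfolding x_def y_def by simp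
  have "(B *\<^sub>v v) @\<^sub>v (E *\<^sub>v v) = sh \<cdot>\<^sub>v (x @\<^sub>v y)"
    using full_svd_right_vector[OF svd' i] mat_mult_append[OF B E v] unfolding v_def sh_def u by simp
  hence top: "((B *\<^sub>v v) @\<^sub>v (E *\<^sub>v v)) $ l = (sh \<cdot>\<^sub>v (x @\<^sub>v y)) $ l" for l by simp
  have Bv: "B *\<^sub>v v = sh \<cdot>\<^sub>v x"
  proof (rule eq_vecI)
    fix l assume "l < dim_vec (sh \<cdot>\<^sub>v x)"
    thus "(B *\<^sub>v v) $ l = (sh \<cdot>\<^sub>v x) $ l" using top[of l] B E x y by (simp del: index_mult_mat_vec)
  qed (use B x in simp)
  have "mat_adjoint B *\<^sub>v x + mat_adjoint E *\<^sub>v y = sh \<cdot>\<^sub>v v"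
    using full_svd_left_vector[OF svd' i] mat_adjoint_append_rows_mult_vec[OF B E x y]
    unfolding v_def sh_def u by simp
  hence "mat_adjoint V *\<^sub>v (mat_adjoint B *\<^sub>v x + mat_adjoint E *\<^sub>v y) = mat_adjoint V *\<^sub>v (sh \<cdot>\<^sub>v v)"
    by simp
  moreover have "mat_adjoint V *\<^sub>v (mat_adjoint B *\<^sub>v x + mat_adjoint E *\<^sub>v y)
      = mat_adjoint V *\<^sub>v (mat_adjoint B *\<^sub>v x) + e"
    unfolding e_def y_def[symmetric] using V B E x y
    by (intro mult_add_distrib_mat_vec) (auto intro!: mult_mat_vec_carrier)
  moreover have "mat_adjoint V *\<^sub>v (sh \<cdot>\<^sub>v v) = sh \<cdot>\<^sub>v q"
    unfolding q_def using V v by (intro mult_mat_vec) auto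
  ultimately have right: "mat_adjoint V *\<^sub>v (mat_adjoint B *\<^sub>v x) + e = sh \<cdot>\<^sub>v q" by simp
  have "mat_adjoint U *\<^sub>v (B *\<^sub>v v) = sh \<cdot>\<^sub>v p"
    unfolding Bv p_def x_def[symmetric] using U x by (intro mult_mat_vec) auto
  hence "(sh \<cdot>\<^sub>v p) $ j = (if j < n then S $$ (j, j) * q $ j else 0)"
    using full_svd_coord[OF svd v j] unfolding q_def by simp
  hence c1: "sh * p $ j = (if j < n then S $$ (j, j) * q $ j else 0)"
    using U j unfolding p_def by (simp del: index_mult_mat_vec)
  thus "\<not> j < n \<Longrightarrow> S' $$ (i, i) * p $ j = 0" unfolding sh_def by simp
  assume jn: "j < n"
  \<comment> \<open>The dual coordinate relation, from the decomposition of the adjoint of \<open>B\<close>.\<close>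
  have c2: "S $$ (j, j) * p $ j + e $ j = sh * q $ j"
  proof -
    have "(mat_adjoint V *\<^sub>v (mat_adjoint B *\<^sub>v x)) $ j = S $$ (j, j) * p $ j"
      using full_svd_coord[OF full_svd_adjoint[OF svd] x jn] j S jn
      unfolding p_def x_def by (simp del: index_mult_mat_vec)
    moreover have "(mat_adjoint V *\<^sub>v (mat_adjoint B *\<^sub>v x) + e) $ j = (sh \<cdot>\<^sub>v q) $ j"
      by (simp only: right)
    ultimately show ?thesis using V jn unfolding e_def q_def by (simp del: index_mult_mat_vec)
  qed
  have "(sh\<^sup>2 - (S $$ (j, j))\<^sup>2) * p $ j = sh * (sh * p $ j) - S $$ (j, j) * (S $$ (j, j) * p $ j)"
    by (simp add: algebra_simps power2_eq_square)
  also have "\<dots> = S $$ (j, j) * (sh * q $ j - S $$ (j, j) * p $ j)"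
    using c1 jn by (simp add: algebra_simps)
  also have "\<dots> = S $$ (j, j) * e $ j" by (simp add: c2[symmetric])
  finally show "((S' $$ (i, i))\<^sup>2 - (S $$ (j, j))\<^sup>2) * p $ j = S $$ (j, j) * e $ j"
    unfolding sh_def by simp
qed

text \<open>For \<open>k \<le> j\<close> the factor relating the two coordinates of index \<open>j\<close> is largest at
  \<open>j = k\<close>, because as \<open>j\<close> grows its numerator cannot grow and its denominator cannot shrink. With
  this common factor pulled out, unitarity of \<open>V\<close> sums the coordinates of \<open>e\<close> to its norm.\<close>

lemma left_singular_vector_tail:
  assumes svd: "full_svd m n B U S V" and E: "E \<in> carrier_mat s n"
    and svd': "full_svd (m + s) n (B @\<^sub>r E) U' S' V'" and k: "k < min m n" and i: "i < min (m + s) n"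
    and gap: "S $$ (k, k) < S' $$ (i, i)"
  defines "e \<equiv> mat_adjoint E *\<^sub>v vec_last (col U' i) s"
  shows "(\<Sum>j=k..<m. (cmod ((mat_adjoint U *\<^sub>v vec_first (col U' i) m) $ j))\<^sup>2)
    \<le> (S $$ (k, k) / ((S' $$ (i, i))\<^sup>2 - (S $$ (k, k))\<^sup>2) * vnorm e)\<^sup>2"
proof -
  define p where "p = mat_adjoint U *\<^sub>v vec_first (col U' i) m"
  define a where "a = S $$ (k, k)"
  define b where "b = S' $$ (i, i)"
  define c where "c = a / (b\<^sup>2 - a\<^sup>2)"
  let ?f = "mat_adjoint V *\<^sub>v e"
  have V: "unitary_mat n V" and a0: "0 \<le> a" using svd k unfolding full_svd_def a_def by auto
  have ab: "a < b" using gap unfolding a_def b_def .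
  have e: "e \<in> carrier_vec n" unfolding e_def using E by (auto intro!: mult_mat_vec_carrier)
  have d0: "0 < b\<^sup>2 - a\<^sup>2" using a0 ab by (simp add: power_strict_mono)
  have bound: "(cmod (p $ j))\<^sup>2 \<le> (if j < n then c\<^sup>2 * (cmod (?f $ j))\<^sup>2 else 0)"
    if j: "k \<le> j" "j < m" for j
  proof (cases "j < n")
    case False
    thus ?thesis using left_singular_vector_coord(2)[OF svd E svd' i j(2) False] a0 ab
      unfolding p_def b_def by (simp del: index_mult_mat_vec)
  next
    case True
    define t where "t = S $$ (j, j)"
    have t: "0 \<le> t" "t \<le> a" using svd j True unfolding full_svd_def a_def t_def by auto
    have d: "b\<^sup>2 - a\<^sup>2 \<le> b\<^sup>2 - t\<^sup>2" using t by (simp add: power_mono)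
    have "(b\<^sup>2 - t\<^sup>2) * p $ j = t * ?f $ j"
      using left_singular_vector_coord(1)[OF svd E svd' i j(2) True]
      unfolding p_def b_def t_def e_def .
    hence "cmod (complex_of_real (b\<^sup>2 - t\<^sup>2) * p $ j) = cmod (complex_of_real t * ?f $ j)"
      by (simp del: index_mult_mat_vec)
    hence eq: "(b\<^sup>2 - t\<^sup>2) * cmod (p $ j) = t * cmod (?f $ j)"
      using d d0 t by (simp only: norm_mult norm_of_real abs_of_nonneg)
    have "(b\<^sup>2 - a\<^sup>2) * cmod (p $ j) \<le> (b\<^sup>2 - t\<^sup>2) * cmod (p $ j)"
      using d by (rule mult_right_mono) simp
    also have "\<dots> \<le> a * cmod (?f $ j)" unfolding eq using t(2) by (rule mult_right_mono) simp
    finally have "cmod (p $ j) \<le> c * cmod (?f $ j)"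
      unfolding c_def using d0 by (simp add: field_simps del: index_mult_mat_vec)
    hence "(cmod (p $ j))\<^sup>2 \<le> (c * cmod (?f $ j))\<^sup>2" by (rule power_mono) simp
    thus ?thesis using True by (simp add: power_mult_distrib del: index_mult_mat_vec)
  qed
  have "(\<Sum>j=k..<m. (cmod (p $ j))\<^sup>2) \<le> (\<Sum>j=k..<m. if j < n then c\<^sup>2 * (cmod (?f $ j))\<^sup>2 else 0)"
    using bound by (intro sum_mono) auto
  also have "\<dots> = (\<Sum>j\<in>{k..<m} \<inter> {..<n}. c\<^sup>2 * (cmod (?f $ j))\<^sup>2)"
    by (simp add: sum.inter_restrict)
  also have "\<dots> \<le> (\<Sum>j<n. c\<^sup>2 * (cmod (?f $ j))\<^sup>2)"
    by (intro sum_mono2) auto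
  also have "\<dots> = (c * vnorm e)\<^sup>2"
    by (simp add: power_mult_distrib vnorm_adjoint_unitary_power2[OF V e] sum_distrib_left
        del: index_mult_mat_vec)
  finally show ?thesis unfolding p_def c_def a_def b_def .
qed

section \<open>Distance from a left singular vector to the range\<close>

theorem proposition4p3:
  shows "\<exists>C::real. C > 0 \<and>
    (\<forall>(m::nat) (n::nat) (s::nat) (k::nat) (B::complex mat) (E::complex mat)
       (U::complex mat) (S::real mat) (V::complex mat)
       (U'::complex mat) (S'::real mat) (V'::complex mat) (i::nat).
      B \<in> carrier_mat m n \<longrightarrow> E \<in> carrier_mat s n \<longrightarrow>
      1 \<le> k \<longrightarrow> k < min m n \<longrightarrow>
      full_svd m n B U S V \<longrightarrow>
      full_svd (m + s) n (B @\<^sub>r E) U' S' V' \<longrightarrow>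
      1 \<le> i \<longrightarrow> i \<le> k \<longrightarrow>
      S' $$ (i - 1, i - 1) \<noteq> S $$ (k, k) \<longrightarrow>
      (let Z = Z_mat m s k U;
           u = col U' (i - 1);
           sh = S' $$ (i - 1, i - 1);
           sk1 = S $$ (k, k);
           y = vec_last u s;
           \<gamma> = C * vnorm (mat_adjoint E *\<^sub>v y)
       in \<exists>z \<in> mat_range Z.
            (\<forall>w \<in> mat_range Z. vnorm (u - z) \<le> vnorm (u - w)) \<and>
            vnorm (u - z) \<le> \<bar>\<gamma> * sk1 / (sk1\<^sup>2 - sh\<^sup>2)\<bar>))"
proof (intro exI[of _ 1] conjI allI impI)
  fix m n s k :: nat and B E U V U' V' :: "complex mat" and S S' :: "real mat" and i :: nat
  assume E: "E \<in> carrier_mat s n" and k: "1 \<le> k" "k < min m n"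
    and svd: "full_svd m n B U S V" and svd': "full_svd (m + s) n (B @\<^sub>r E) U' S' V'"
    and i: "1 \<le> i" "i \<le> k" and ne: "S' $$ (i - 1, i - 1) \<noteq> S $$ (k, k)"
  define u where "u = col U' (i - 1)"
  define a where "a = S $$ (k, k)"
  define b where "b = S' $$ (i - 1, i - 1)"
  define e where "e = mat_adjoint E *\<^sub>v vec_last u s"
  have "a \<le> S $$ (i - 1, i - 1)" using svd k i unfolding full_svd_def a_def by auto
  also have "\<dots> \<le> b"
    unfolding b_def using k i by (intro singular_value_append_rows_mono[OF svd E svd']) auto
  finally have gap: "a < b" using ne unfolding a_def b_def by simp
  have U: "unitary_mat m U" and a0: "0 \<le> a" using svd k unfolding full_svd_def a_def by auto
  have "U' \<in> carrier_mat (m + s) (m + s)" using svd' unfolding full_svd_def unitary_mat_def by auto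
  hence uc: "u \<in> carrier_vec (m + s)" unfolding u_def by (intro carrier_vecI) simp
  obtain z where z: "z \<in> mat_range (Z_mat m s k U)"
    "\<forall>w\<in>mat_range (Z_mat m s k U). vnorm (u - z) \<le> vnorm (u - w)"
    "(vnorm (u - z))\<^sup>2 = (\<Sum>j=k..<m. (cmod ((mat_adjoint U *\<^sub>v vec_first u m) $ j))\<^sup>2)"
    using best_approximation_Z_mat[OF U _ uc, of k] k by auto
  have "(vnorm (u - z))\<^sup>2 \<le> (a / (b\<^sup>2 - a\<^sup>2) * vnorm e)\<^sup>2"
    unfolding z(3) unfolding a_def b_def e_def u_def
    using k i gap[unfolded a_def b_def] by (intro left_singular_vector_tail[OF svd E svd']) auto
  moreover have "0 \<le> a / (b\<^sup>2 - a\<^sup>2) * vnorm e"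
    using a0 gap by (simp add: power_mono vnorm_nonneg)
  ultimately have "vnorm (u - z) \<le> a / (b\<^sup>2 - a\<^sup>2) * vnorm e" by (rule power2_le_imp_le)
  also have "\<dots> \<le> \<bar>a / (b\<^sup>2 - a\<^sup>2) * vnorm e\<bar>" by (rule abs_ge_self)
  also have "\<dots> = \<bar>1 * vnorm e * a / (a\<^sup>2 - b\<^sup>2)\<bar>"
    by (simp add: abs_mult abs_minus_commute)
  finally show "let Z = Z_mat m s k U; u = col U' (i - 1); sh = S' $$ (i - 1, i - 1);
      sk1 = S $$ (k, k); y = vec_last u s; \<gamma> = 1 * vnorm (mat_adjoint E *\<^sub>v y)
    in \<exists>z\<in>mat_range Z. (\<forall>w\<in>mat_range Z. vnorm (u - z) \<le> vnorm (u - w)) \<and>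
      vnorm (u - z) \<le> \<bar>\<gamma> * sk1 / (sk1\<^sup>2 - sh\<^sup>2)\<bar>"
    using z(1,2) unfolding Let_def u_def a_def b_def e_def by blast
qed simp

end
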